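(* Let $(\mathfrak{h}_2,\alpha)$ be a multiplicative Heisenberg Hom-Lie superalgebra over $\mathbb{C}$. Every infinitesimal deformation of $(\mathfrak{h}_{2},\alpha)$ which is not a Lie superalgebra is isomorphic, as a Hom-Lie superalgebra, to $L_{1,2}^{43,1}$, $L_{1,2}^{45,1}$, or $L_{1,2}^{46,1,0}$ (for some values of their structure constants $\beta,\gamma,\nu,\mu\in\mathbb{C}$).
   Context: A Hom-Lie superalgebra $\mathfrak{g}=(V,[\cdot,\cdot],\alpha)$ over $\mathbb{C}$ consists of a $\mathbb{Z}_2$-graded vector space $V=V_{\bar 0}\oplus V_{\bar 1}$, an even bilinear map $[\cdot,\cdot]$ and an even linear map $\alpha:V\to V$ such that for homogeneous $x,y,z$: $[x,y]=-(-1)^{|x||y|}[y,x]$ and $\circlearrowleft_{x,y,z}(-1)^{|x||z|}[\alpha(x),[y,z]]=0$ (cyclic sum). It is multiplicative if $\alpha([x,y])=[\alpha(x),\alpha(y)]$. Two Hom-Lie superalgebras are isomorphic if there is an even bijective linear map $\phi$ between them preserving brackets and with $\phi\circ\alpha=\beta\circ\phi$ for the twisting maps $\alpha,\beta$. $\mathfrak{h}_2$: basis $\{u\mid v,h\}$ ($u$ even, $v,h$ odd), $[u,v]=-[v,u]=h$, other brackets of basis elements zero. $(\mathfrak{h}_2,\alpha)$ denotes $\mathfrak{h}_2$ with twisting map $\alpha$. The following Hom-Lie superalgebras have basis $\{e_1\mid e_2,e_3\}$ ($e_1$ even, $e_2,e_3$ odd), complex structure constants $\beta,\gamma,\nu,\mu$,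 and twisting map $\sigma$ given in the basis $(e_1,e_2,e_3)$, columns being images of basis vectors. $L_{1,2}^{43,a}$ ($a\neq0$): $[e_1,e_2]=0$, $[e_1,e_3]=\beta e_2$, $[e_2,e_2]=0$, $[e_2,e_3]=0$, $[e_3,e_3]=\gamma e_1$, $\sigma=\begin{pmatrix}0&0&0\\0&0&a\\0&0&0\end{pmatrix}$. $L_{1,2}^{45,a}$ ($a\neq0$): $[e_1,e_2]=0$, $[e_1,e_3]=\beta e_2$, $[e_2,e_2]=0$, $[e_2,e_3]=\nu e_1$, $[e_3,e_3]=\gamma e_1$, $\sigma=\begin{pmatrix}0&0&0\\0&0&a\\0&0&0\end{pmatrix}$. $L_{1,2}^{46,a,b}$ ($a^2+b^2\neq0$): $[e_1,e_2]=0$, $[e_1,e_3]=\beta e_2$, $[e_2,e_2]=0$, $[e_2,e_3]=\mu e_1$, $[e_3,e_3]=0$, $\sigma=\begin{pmatrix}0&0&0\\0&0&a\\0&0&b\end{pmatrix}$. Infinitesimal deformations: let $\mathfrak{g}=(V,[\cdot,\cdot]_0,\alpha)$ be a Hom-Lie superalgebra and $\varphi:V\times V\to V$ an even bilinear map commuting with $\alpha$ ($\alpha(\varphi(x,y))=\varphi(\alpha(x),\alpha(y))$). The map $[\cdot,\cdot]_t=[\cdot,\cdot]_0+t\varphi(\cdot,\cdot)$, or the Hom-Lie superalgebra $\mathfrak{g}_t=(V,[\cdot,\cdot]_t,\alpha)$, is an infinitesimal deformation of $\mathfrak{g}$ if $[x,y]_t=-(-1)^{|x||y|}[y,x]_t$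 and $\circlearrowleft_{x,y,z}(-1)^{|x||z|}[\alpha(x),[y,z]_t]_t=0$ identically in the parameter $t$. For isomorphism types, $t$ is a nonzero complex parameter. The deformation is a Lie superalgebra if $(V,[\cdot,\cdot]_t)$ satisfies the ordinary super Jacobi identity $\circlearrowleft_{x,y,z}(-1)^{|x||z|}[x,[y,z]_t]_t=0$.
   Formalization: The twisting map α is assumed nonzero: for α = 0 the claim fails, e.g. φ(v,v)=u gives a non-Lie deformation with zero twisting map, which cannot be isomorphic to any of the listed algebras since their twisting maps are nonzero. *)

theory Defs
  imports "HOL-Analysis.Analysis" "HOL-Library.Z2"
begin

text \<open>
  The underlying space of a superalgebra is a whole type, with an explicit complex scalar
  multiplication; the grading group of order two is the type \<open>bit\<close>, so that \<open>part A 0\<close> and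
  \<open>part A 1\<close> are the even and the odd part.
\<close>

record 'a hom_superalgebra =
  scal :: "complex \<Rightarrow> 'a \<Rightarrow> 'a"
  part :: "bit \<Rightarrow> 'a set"
  brk :: "'a \<Rightarrow> 'a \<Rightarrow> 'a"
  twist :: "'a \<Rightarrow> 'a"

definition super_space :: "('a::ab_group_add, 'z) hom_superalgebra_scheme \<Rightarrow> bool" where
  "super_space A \<longleftrightarrow>
     vector_space (scal A) \<and>
     (\<forall>i. module.subspace (scal A) (part A i)) \<and>
     part A 0 \<inter> part A 1 = {0} \<and>
     (\<forall>x. \<exists>y\<in>part A 0. \<exists>z\<in>part A 1. x = y + z)"

definition even_linear ::
  "('a::ab_group_add, 'z) hom_superalgebra_scheme \<Rightarrow>
   ('b::ab_group_add, 'w) hom_superalgebra_scheme \<Rightarrow> ('a \<Rightarrow> 'b) \<Rightarrow> bool" where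
  "even_linear A B f \<longleftrightarrow>
     Vector_Spaces.linear (scal A) (scal B) f \<and>
     (\<forall>i. \<forall>x\<in>part A i. f x \<in> part B i)"

definition even_bilinear ::
  "('a::ab_group_add, 'z) hom_superalgebra_scheme \<Rightarrow> ('a \<Rightarrow> 'a \<Rightarrow> 'a) \<Rightarrow> bool" where
  "even_bilinear A f \<longleftrightarrow>
     (\<forall>x. Vector_Spaces.linear (scal A) (scal A) (\<lambda>y. f x y)) \<and>
     (\<forall>y. Vector_Spaces.linear (scal A) (scal A) (\<lambda>x. f x y)) \<and>
     (\<forall>i j. \<forall>x\<in>part A i. \<forall>y\<in>part A j. f x y \<in> part A (i + j))"

text \<open>The sign \<open>(-1)\<^sup>i\<^sup>j\<close> for degrees \<open>i\<close>, \<open>j\<close>.\<close>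

definition super_sign :: "bit \<Rightarrow> bit \<Rightarrow> complex" where
  "super_sign i j = (if i = 1 \<and> j = 1 then - 1 else 1)"

definition super_skew :: "('a::ab_group_add, 'z) hom_superalgebra_scheme \<Rightarrow> bool" where
  "super_skew A \<longleftrightarrow>
     (\<forall>i j. \<forall>x\<in>part A i. \<forall>y\<in>part A j.
        brk A x y = - scal A (super_sign i j) (brk A y x))"

definition hom_jacobi :: "('a::ab_group_add, 'z) hom_superalgebra_scheme \<Rightarrow> bool" where
  "hom_jacobi A \<longleftrightarrow>
     (\<forall>i j k. \<forall>x\<in>part A i. \<forall>y\<in>part A j. \<forall>z\<in>part A k.
        scal A (super_sign i k) (brk A (twist A x) (brk A y z)) +
        scal A (super_sign j i) (brk A (twist A y) (brk A z x)) +
        scal A (super_sign k j) (brk A (twist A z) (brk A x y)) = 0)"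

definition super_jacobi :: "('a::ab_group_add, 'z) hom_superalgebra_scheme \<Rightarrow> bool" where
  "super_jacobi A \<longleftrightarrow>
     (\<forall>i j k. \<forall>x\<in>part A i. \<forall>y\<in>part A j. \<forall>z\<in>part A k.
        scal A (super_sign i k) (brk A x (brk A y z)) +
        scal A (super_sign j i) (brk A y (brk A z x)) +
        scal A (super_sign k j) (brk A z (brk A x y)) = 0)"

definition hom_lie_superalgebra :: "('a::ab_group_add, 'z) hom_superalgebra_scheme \<Rightarrow> bool" where
  "hom_lie_superalgebra A \<longleftrightarrow>
     super_space A \<and> even_bilinear A (brk A) \<and> even_linear A A (twist A) \<and>
     super_skew A \<and> hom_jacobi A"

definition multiplicative :: "('a::ab_group_add, 'z) hom_superalgebra_scheme \<Rightarrow> bool" where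
  "multiplicative A \<longleftrightarrow> (\<forall>x y. twist A (brk A x y) = brk A (twist A x) (twist A y))"

text \<open>The twisting map plays no role here.\<close>

definition lie_superalgebra :: "('a::ab_group_add, 'z) hom_superalgebra_scheme \<Rightarrow> bool" where
  "lie_superalgebra A \<longleftrightarrow>
     super_space A \<and> even_bilinear A (brk A) \<and> super_skew A \<and> super_jacobi A"

definition hom_lie_isomorphic ::
  "('a::ab_group_add, 'z) hom_superalgebra_scheme \<Rightarrow>
   ('b::ab_group_add, 'w) hom_superalgebra_scheme \<Rightarrow> bool" where
  "hom_lie_isomorphic A B \<longleftrightarrow>
     (\<exists>f. even_linear A B f \<and> bij f \<and>
          (\<forall>x y. f (brk A x y) = brk B (f x) (f y)) \<and>
          (\<forall>x. f (twist A x) = twist B (f x)))"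

definition deform ::
  "('a::ab_group_add, 'z) hom_superalgebra_scheme \<Rightarrow> ('a \<Rightarrow> 'a \<Rightarrow> 'a) \<Rightarrow> complex \<Rightarrow>
   ('a, 'z) hom_superalgebra_scheme" where
  "deform A \<phi> t = A\<lparr>brk := (\<lambda>x y. brk A x y + scal A t (\<phi> x y))\<rparr>"

text \<open>
  The bilinear map \<open>\<phi>\<close> determines the whole family of brackets; the identities are required for
  every value of the parameter.
\<close>

definition infinitesimal_deformation ::
  "('a::ab_group_add, 'z) hom_superalgebra_scheme \<Rightarrow> ('a \<Rightarrow> 'a \<Rightarrow> 'a) \<Rightarrow> bool" where
  "infinitesimal_deformation A \<phi> \<longleftrightarrow>
     even_bilinear A \<phi> \<and>
     (\<forall>x y. twist A (\<phi> x y) = \<phi> (twist A x) (twist A y)) \<and>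
     (\<forall>t. super_skew (deform A \<phi> t) \<and> hom_jacobi (deform A \<phi> t))"

text \<open>
  Superdimension \<open>(1|2)\<close>: the first standard basis vector of \<open>complex ^ 3\<close> is even, the other
  two are odd.
\<close>

definition part12 :: "bit \<Rightarrow> (complex ^ 3) set" where
  "part12 i = (if i = 0 then vec.span {axis 1 1} else vec.span {axis 2 1, axis 3 1})"

text \<open>
  The bilinear, super skew-symmetric extension of \<open>[e\<^sub>i, e\<^sub>j] = b\<^sub>i\<^sub>j\<close> for
  \<open>ij = 12, 13, 22, 23, 33\<close>; super skew-symmetry forces \<open>[e\<^sub>1, e\<^sub>1] = 0\<close>,
  \<open>[e\<^sub>2, e\<^sub>1] = - b\<^sub>1\<^sub>2\<close>, \<open>[e\<^sub>3, e\<^sub>1] = - b\<^sub>1\<^sub>3\<close> and \<open>[e\<^sub>3, e\<^sub>2] = b\<^sub>2\<^sub>3\<close>.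
\<close>

definition bracket12 ::
  "complex ^ 3 \<Rightarrow> complex ^ 3 \<Rightarrow> complex ^ 3 \<Rightarrow> complex ^ 3 \<Rightarrow> complex ^ 3 \<Rightarrow>
   complex ^ 3 \<Rightarrow> complex ^ 3 \<Rightarrow> complex ^ 3" where
  "bracket12 b12 b13 b22 b23 b33 x y =
     (x $ 1 * y $ 2 - x $ 2 * y $ 1) *s b12 +
     (x $ 1 * y $ 3 - x $ 3 * y $ 1) *s b13 +
     (x $ 2 * y $ 2) *s b22 +
     (x $ 2 * y $ 3 + x $ 3 * y $ 2) *s b23 +
     (x $ 3 * y $ 3) *s b33"

text \<open>The basis \<open>u | v, h\<close> is the standard basis, in this order.\<close>

definition heisenberg_h2 ::
  "(complex ^ 3 \<Rightarrow> complex ^ 3) \<Rightarrow> (complex ^ 3) hom_superalgebra" where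
  "heisenberg_h2 \<alpha> =
     \<lparr>scal = (*s), part = part12, brk = bracket12 (axis 3 1) 0 0 0 0, twist = \<alpha>\<rparr>"

text \<open>
  The families \<open>L\<^sub>1\<^sub>,\<^sub>2\<close> with upper index \<open>43,a\<close>, then \<open>45,a\<close>, then \<open>46,a,b\<close>; the
  conditions \<open>a \<noteq> 0\<close> and \<open>a\<^sup>2 + b\<^sup>2 \<noteq> 0\<close> on the parameters are left to the user.
\<close>

definition L43 :: "complex \<Rightarrow> complex \<Rightarrow> complex \<Rightarrow> (complex ^ 3) hom_superalgebra" where
  "L43 a \<beta> \<gamma> =
     \<lparr>scal = (*s), part = part12,
      brk = bracket12 0 (\<beta> *s axis 2 1) 0 0 (\<gamma> *s axis 1 1),
      twist = (*v) (vector [vector [0, 0, 0],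
                            vector [0, 0, a],
                            vector [0, 0, 0]])\<rparr>"

definition L45 ::
  "complex \<Rightarrow> complex \<Rightarrow> complex \<Rightarrow> complex \<Rightarrow> (complex ^ 3) hom_superalgebra" where
  "L45 a \<beta> \<nu> \<gamma> =
     \<lparr>scal = (*s), part = part12,
      brk = bracket12 0 (\<beta> *s axis 2 1) 0 (\<nu> *s axis 1 1) (\<gamma> *s axis 1 1),
      twist = (*v) (vector [vector [0, 0, 0],
                            vector [0, 0, a],
                            vector [0, 0, 0]])\<rparr>"

definition L46 ::
  "complex \<Rightarrow> complex \<Rightarrow> complex \<Rightarrow> complex \<Rightarrow> (complex ^ 3) hom_superalgebra" where
  "L46 a b \<beta> \<mu> =
     \<lparr>scal = (*s), part = part12,
      brk = bracket12 0 (\<beta> *s axis 2 1) 0 (\<mu> *s axis 1 1) 0,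
      twist = (*v) (vector [vector [0, 0, 0],
                            vector [0, 0, a],
                            vector [0, 0, b]])\<rparr>"

end

theory Submission
  imports Defs
begin

text \<open>
  The result is a computation in coordinates, and the case \<open>L\<^sub>1\<^sub>,\<^sub>2\<close> with upper index \<open>45,1\<close>
  always occurs: it contains \<open>43,1\<close> as \<open>\<nu> = 0\<close> and \<open>46,1,0\<close> as \<open>\<gamma> = 0\<close>.

  An even linear \<open>\<alpha>\<close> on \<open>u | v, h\<close> has the form
  \<open>u \<mapsto> p u\<close>, \<open>v \<mapsto> a v + b h\<close>, \<open>h \<mapsto> c v + d h\<close>, and multiplicativity on \<open>[u, v] = h\<close> gives
  \<open>c = 0\<close>, \<open>d = p a\<close>. A deforming map has the form \<open>\<phi>(u, v) = r v + s h\<close>,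
  \<open>\<phi>(u, h) = w v + q h\<close>, and on odd vectors \<open>\<phi>(y, z) = \<omega>(y, z) u\<close> for a symmetric form \<open>\<omega>\<close>
  with entries \<open>A, B, C\<close>. If \<open>\<omega> = 0\<close>, then odd vectors have zero brackets and the deformation is
  a Lie superalgebra (\<open>lie_superalgebra_if_odd_brackets_zero\<close>). So \<open>\<omega> \<noteq> 0\<close> may be assumed.

  The decisive identity is the Hom-Jacobi identity at \<open>(y, y, y)\<close> for odd \<open>y\<close>, which says
  \<open>[\<alpha>(y), [y, y]] = 0\<close> (\<open>hom_jacobi_odd_cube\<close>). For the deformed bracket the left-hand side is
  \<open>- t \<omega>(y, y) [u, \<alpha>(y)]\<^sub>t\<close>. Its first-order part in \<open>t\<close> has the coefficient
  \<open>\<omega>(y, y) a y\<^sub>v\<close> at \<open>h\<close>, where \<open>y\<^sub>v\<close> is the coordinate of \<open>y\<close> at \<open>v\<close>; a nonzero quadratic form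
  cannot vanish at all \<open>y\<close> with \<open>y\<^sub>v \<noteq> 0\<close> (\<open>quadratic_form_eq_0\<close>), so \<open>a = 0\<close>, and hence \<open>\<alpha>(h) = 0\<close>.
  As \<open>\<phi>\<close> commutes with \<open>\<alpha>\<close>, this gives \<open>p A = b\<^sup>2 C\<close> and \<open>p B = p C = 0\<close>, so \<open>p = 0\<close>. Since
  \<open>\<alpha> \<noteq> 0\<close>, now \<open>b \<noteq> 0\<close>, and commutation also gives \<open>C = r = w = 0\<close>. The second-order part of the
  identity is then \<open>\<omega>(y, y) b q y\<^sub>v = 0\<close>, so \<open>q = 0\<close>.

  What remains is \<open>\<alpha>(v) = b h\<close>, \<open>[u, v] = (1 + t s) h\<close>, \<open>[v, v] = t A u\<close>, \<open>[v, h] = t B u\<close>. In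
  the basis \<open>e\<^sub>1 = u\<close>, \<open>e\<^sub>2 = b h\<close>, \<open>e\<^sub>3 = v\<close> this is the algebra \<open>L45\<close> with \<open>a = 1\<close>
  (\<open>isomorphic_L45\<close>).
\<close>

lemma part12_0: "part12 0 = {x. x $ 2 = 0 \<and> x $ 3 = 0}"
proof -
  have "x = (x $ 1) *s axis 1 1" if "x $ 2 = 0" "x $ 3 = 0" for x :: "complex ^ 3"
    using that by (simp add: vec_eq_iff forall_3 axis_def)
  then show ?thesis
    by (auto simp: part12_def vec.span_singleton axis_def)
qed

lemma part12_1: "part12 1 = {x. x $ 1 = 0}"
proof -
  have "x - (x $ 2) *s axis 2 1 = (x $ 3) *s axis 3 1" if "x $ 1 = 0" for x :: "complex ^ 3"
    using that by (simp add: vec_eq_iff forall_3 axis_def)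
  moreover have "x $ 1 = 0" if "x - k *s axis 2 1 = l *s axis 3 1" for x :: "complex ^ 3" and k l
    using that by (simp add: vec_eq_iff forall_3 axis_def)
  ultimately show ?thesis
    by (auto simp: part12_def vec.span_insert vec.span_singleton)
qed

lemma all_bit: "(\<forall>i. P i) \<longleftrightarrow> P (0::bit) \<and> P 1"
  by (metis bit_not_one_iff)

lemma super_sign_simps [simp]:
  "super_sign 0 i = 1" "super_sign i 0 = 1" "super_sign 1 1 = - 1"
  by (simp_all add: super_sign_def)

lemma linear_expansion_3:
  fixes f :: "complex ^ 3 \<Rightarrow> complex ^ 3"
  assumes "Vector_Spaces.linear (*s) (*s) f"
  shows "f x = (x $ 1) *s f (axis 1 1) + (x $ 2) *s f (axis 2 1) + (x $ 3) *s f (axis 3 1)"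
proof -
  interpret Vector_Spaces.linear "(*s)" "(*s)" f by fact
  have "x = (x $ 1) *s axis 1 1 + (x $ 2) *s axis 2 1 + (x $ 3) *s axis 3 1"
    by (simp add: vec_eq_iff forall_3 axis_def)
  then have "f x = f ((x $ 1) *s axis 1 1 + (x $ 2) *s axis 2 1 + (x $ 3) *s axis 3 1)"
    by simp
  then show ?thesis by (simp add: add scale)
qed

lemma vector_0_3: "vector [0, 0, 0] = (0 :: 'a::zero ^ 3)"
  by (simp add: vec_eq_iff forall_3)

lemma linear_vecI:
  fixes f :: "complex ^ 'n \<Rightarrow> complex ^ 'm"
  assumes "\<And>x y. f (x + y) = f x + f y" "\<And>c x. f (c *s x) = c *s f x"
  shows "Vector_Spaces.linear (*s) (*s) f"
  using assms by unfold_locales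

lemma even_linear_12_eq:
  fixes f :: "complex ^ 3 \<Rightarrow> complex ^ 3"
  assumes "Vector_Spaces.linear (*s) (*s) f" "\<And>i x. x \<in> part12 i \<Longrightarrow> f x \<in> part12 i"
  obtains p a b c d
  where "\<And>x. f x = vector [p * x $ 1, a * x $ 2 + c * x $ 3, b * x $ 2 + d * x $ 3]"
proof
  have "f (axis 1 1) $ 2 = 0" "f (axis 1 1) $ 3 = 0"
    using assms(2)[of "axis 1 1" 0] by (simp_all add: part12_0 axis_def)
  moreover have "f (axis 2 1) $ 1 = 0" "f (axis 3 1) $ 1 = 0"
    using assms(2)[of "axis 2 1" 1] assms(2)[of "axis 3 1" 1]
    by (simp_all add: part12_1 axis_def)
  ultimately show "f x = vector
      [f (axis 1 1) $ 1 * x $ 1,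
       f (axis 2 1) $ 2 * x $ 2 + f (axis 3 1) $ 2 * x $ 3,
       f (axis 2 1) $ 3 * x $ 2 + f (axis 3 1) $ 3 * x $ 3]" for x
    by (subst linear_expansion_3[OF assms(1)]) (simp add: vec_eq_iff forall_3 algebra_simps)
qed

text \<open>
  Evenness removes the coordinates of the wrong degree; super skew-symmetry gives \<open>f(e\<^sub>1, e\<^sub>1) = 0\<close>
  and reduces the other values on the basis to the five arguments of \<open>bracket12\<close>.
\<close>

lemma even_bilinear_12_eq:
  fixes f :: "complex ^ 3 \<Rightarrow> complex ^ 3 \<Rightarrow> complex ^ 3"
  assumes lin: "\<And>x. Vector_Spaces.linear (*s) (*s) (f x)"
      "\<And>y. Vector_Spaces.linear (*s) (*s) (\<lambda>x. f x y)"
    and even: "\<And>i j x y. x \<in> part12 i \<Longrightarrow> y \<in> part12 j \<Longrightarrow> f x y \<in> part12 (i + j)"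
    and skew: "\<And>i j x y. x \<in> part12 i \<Longrightarrow> y \<in> part12 j \<Longrightarrow> f x y = - (super_sign i j *s f y x)"
  obtains r s w q A B C
  where "f = bracket12 (vector [0, r, s]) (vector [0, w, q])
               (vector [A, 0, 0]) (vector [B, 0, 0]) (vector [C, 0, 0])"
proof
  let ?e1 = "axis 1 1 :: complex ^ 3"
    and ?e2 = "axis 2 1 :: complex ^ 3"
    and ?e3 = "axis 3 1 :: complex ^ 3"
  have mem: "?e1 \<in> part12 0" "?e2 \<in> part12 1" "?e3 \<in> part12 1"
    by (simp_all add: part12_0 part12_1 axis_def)
  have ev: "f ?e1 ?e2 $ 1 = 0" "f ?e1 ?e3 $ 1 = 0"
      "f ?e2 ?e2 $ 2 = 0" "f ?e2 ?e2 $ 3 = 0" "f ?e2 ?e3 $ 2 = 0" "f ?e2 ?e3 $ 3 = 0"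
      "f ?e3 ?e3 $ 2 = 0" "f ?e3 ?e3 $ 3 = 0"
    using even[OF mem(1) mem(2)] even[OF mem(1) mem(3)] even[OF mem(2) mem(2)]
      even[OF mem(2) mem(3)] even[OF mem(3) mem(3)]
    by (simp_all add: part12_0 part12_1)
  have "f ?e1 ?e1 = - f ?e1 ?e1"
    using skew[OF mem(1) mem(1)] by simp
  then have sk: "f ?e1 ?e1 = 0"
    "f ?e2 ?e1 = - f ?e1 ?e2" "f ?e3 ?e1 = - f ?e1 ?e3" "f ?e3 ?e2 = f ?e2 ?e3"
    using skew[OF mem(2) mem(1)] skew[OF mem(3) mem(1)] skew[OF mem(3) mem(2)]
    by (simp_all add: vec_eq_iff)
  show "f = bracket12
      (vector [0, f ?e1 ?e2 $ 2, f ?e1 ?e2 $ 3]) (vector [0, f ?e1 ?e3 $ 2, f ?e1 ?e3 $ 3])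
      (vector [f ?e2 ?e2 $ 1, 0, 0]) (vector [f ?e2 ?e3 $ 1, 0, 0])
      (vector [f ?e3 ?e3 $ 1, 0, 0])"
  proof (intro ext)
    fix x y
    have "f x y = (y $ 1) *s f x ?e1 + (y $ 2) *s f x ?e2 + (y $ 3) *s f x ?e3"
      by (rule linear_expansion_3[OF lin(1)])
    also have "\<dots> = (y $ 1) *s ((x $ 1) *s f ?e1 ?e1 + (x $ 2) *s f ?e2 ?e1 + (x $ 3) *s f ?e3 ?e1)
       + (y $ 2) *s ((x $ 1) *s f ?e1 ?e2 + (x $ 2) *s f ?e2 ?e2 + (x $ 3) *s f ?e3 ?e2)
       + (y $ 3) *s ((x $ 1) *s f ?e1 ?e3 + (x $ 2) *s f ?e2 ?e3 + (x $ 3) *s f ?e3 ?e3)"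
      using linear_expansion_3[OF lin(2)] by metis
    finally show "f x y = bracket12
      (vector [0, f ?e1 ?e2 $ 2, f ?e1 ?e2 $ 3]) (vector [0, f ?e1 ?e3 $ 2, f ?e1 ?e3 $ 3])
      (vector [f ?e2 ?e2 $ 1, 0, 0]) (vector [f ?e2 ?e3 $ 1, 0, 0])
      (vector [f ?e3 ?e3 $ 1, 0, 0]) x y"
      by (simp add: sk bracket12_def vec_eq_iff forall_3 ev algebra_simps)
  qed
qed

text \<open>
  In the super Jacobi identity every double bracket with two odd arguments and one even argument,
  or with three of equal degree, contains a zero bracket. For even \<open>x\<close>, \<open>x'\<close> and odd \<open>y\<close> the terms
  \<open>[x, [x', y]]\<close> and \<open>[x', [y, x]]\<close> cancel because the even part is one-dimensional.
\<close>

lemma lie_superalgebra_if_odd_brackets_zero: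
  assumes "super_space G" "scal G = (*s)" "part G = part12"
    and "brk G = bracket12 b12 b13 0 0 0" "b12 $ 1 = 0" "b13 $ 1 = 0"
  shows "lie_superalgebra G"
proof -
  have "even_bilinear G (brk G)"
    unfolding even_bilinear_def assms(2-4) all_bit
    using assms(5,6)
    by (auto intro!: linear_vecI
        simp: bracket12_def part12_0 part12_1 vec_eq_iff algebra_simps)
  moreover have "super_skew G"
    unfolding super_skew_def assms(2-4) all_bit
    by (auto simp: bracket12_def part12_0 part12_1 vec_eq_iff algebra_simps)
  moreover have "super_jacobi G"
    unfolding super_jacobi_def assms(2-4) all_bit
    using assms(5,6)
    by (auto simp: bracket12_def part12_0 part12_1 vec_eq_iff algebra_simps)
  ultimately show ?thesis
    using assms(1) by (simp add: lie_superalgebra_def)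
qed

text \<open>
  The three cyclic terms coincide and all carry the sign \<open>- 1\<close>, so three times the double bracket
  vanishes.
\<close>

lemma hom_jacobi_odd_cube:
  assumes "hom_jacobi G" "y \<in> part G 1" "scal G = (*s)"
  shows "brk G (twist G y) (brk G y y) = (0 :: complex ^ 3)"
proof -
  let ?z = "brk G (twist G y) (brk G y y)"
  have "(- 1) *s ?z + (- 1) *s ?z + (- 1) *s ?z = 0"
    using assms unfolding hom_jacobi_def by (metis super_sign_simps(3))
  then show ?thesis
    by (simp add: vec_eq_iff)
qed

text \<open>
  This turns the first-order and the second-order part of the odd Hom-Jacobi identity, for all odd
  vectors with coordinates \<open>x\<close>, \<open>y\<close>, into the vanishing of their coefficient \<open>k\<close> whenever the form
  is nonzero. The points \<open>(1, 0)\<close>, \<open>(1, 1)\<close> and \<open>(1, - 1)\<close> determine the form.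
\<close>

lemma quadratic_form_eq_0:
  fixes A B C k :: complex
  assumes "\<And>x y. (x * x * A + 2 * (x * y) * B + y * y * C) * (k * x) = 0" "k \<noteq> 0"
  shows "A = 0" "B = 0" "C = 0"
proof -
  show A: "A = 0"
    using assms(1)[of 1 0] assms(2) by simp
  have "2 * B + C = 0" "C - 2 * B = 0"
    using assms(1)[of 1 1] assms(1)[of 1 "- 1"] assms(2) A by simp_all
  then have "(2 * B + C) + (C - 2 * B) = 0" by simp
  then show C: "C = 0" by simp
  then show "B = 0"
    using \<open>2 * B + C = 0\<close> by simp
qed

text \<open>
  Rescaling \<open>h\<close> to \<open>e\<^sub>2 = b h\<close> normalises the twisting map to \<open>e\<^sub>3 \<mapsto> e\<^sub>2\<close>, where \<open>e\<^sub>3 = v\<close>; the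
  factor \<open>b\<close> moves into the structure constants.
\<close>

lemma isomorphic_L45:
  assumes G: "scal G = (*s)" "part G = part12"
    and br: "brk G = bracket12 (vector [0, 0, k]) 0 (vector [A, 0, 0]) (vector [B, 0, 0]) 0"
    and tw: "\<And>x. twist G x = vector [0, 0, b * x $ 2]"
    and "b \<noteq> 0"
  shows "hom_lie_isomorphic G (L45 1 (k / b) (b * B) A)"
proof -
  define f :: "complex ^ 3 \<Rightarrow> complex ^ 3" where "f x = vector [x $ 1, x $ 3 / b, x $ 2]" for x
  define g :: "complex ^ 3 \<Rightarrow> complex ^ 3" where "g x = vector [x $ 1, x $ 3, x $ 2 * b]" for x
  have "even_linear G (L45 1 (k / b) (b * B) A) f"
    by (auto intro!: linear_vecI
        simp: even_linear_def L45_def G all_bit part12_0 part12_1 f_def vec_eq_iff forall_3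
          add_divide_distrib)
  moreover have "bij f"
    using \<open>b \<noteq> 0\<close>
    by (intro o_bij[of g]) (auto simp: f_def g_def fun_eq_iff vec_eq_iff forall_3)
  moreover have "f (brk G x y) = brk (L45 1 (k / b) (b * B) A) (f x) (f y)" for x y
    using \<open>b \<noteq> 0\<close>
    by (simp add: br L45_def f_def bracket12_def vec_eq_iff forall_3 axis_def field_simps)
  moreover have "f (twist G x) = twist (L45 1 (k / b) (b * B) A) (f x)" for x
    using \<open>b \<noteq> 0\<close>
    by (simp add: tw L45_def f_def matrix_vector_mult_def vec_eq_iff forall_3 sum_3)
  ultimately show ?thesis
    unfolding hom_lie_isomorphic_def by blast
qed

theorem proposition5p7:
  fixes \<alpha> :: "complex ^ 3 \<Rightarrow> complex ^ 3"
    and \<phi> :: "complex ^ 3 \<Rightarrow> complex ^ 3 \<Rightarrow> complex ^ 3"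
    and t :: complex
  assumes "hom_lie_superalgebra (heisenberg_h2 \<alpha>)"
    and "multiplicative (heisenberg_h2 \<alpha>)"
    and "\<alpha> \<noteq> (\<lambda>x. 0)"
    and "infinitesimal_deformation (heisenberg_h2 \<alpha>) \<phi>"
    and "t \<noteq> 0"
    and "\<not> lie_superalgebra (deform (heisenberg_h2 \<alpha>) \<phi> t)"
  shows "(\<exists>\<beta> \<gamma>. hom_lie_isomorphic (deform (heisenberg_h2 \<alpha>) \<phi> t) (L43 1 \<beta> \<gamma>)) \<or>
         (\<exists>\<beta> \<nu> \<gamma>. hom_lie_isomorphic (deform (heisenberg_h2 \<alpha>) \<phi> t) (L45 1 \<beta> \<nu> \<gamma>)) \<or>
         (\<exists>\<beta> \<mu>. hom_lie_isomorphic (deform (heisenberg_h2 \<alpha>) \<phi> t) (L46 1 0 \<beta> \<mu>))"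
proof -
  define D where "D t = deform (heisenberg_h2 \<alpha>) \<phi> t" for t
  have D_sel [simp]: "scal (D t) = (*s)" "part (D t) = part12" "twist (D t) = \<alpha>" for t
    by (simp_all add: D_def deform_def heisenberg_h2_def)
  have D_brk: "brk (D t) = (\<lambda>x y. bracket12 (axis 3 1) 0 0 0 0 x y + t *s \<phi> x y)" for t
    by (simp add: D_def deform_def heisenberg_h2_def)
  have skew: "super_skew (D t)" and jac: "hom_jacobi (D t)" for t
    using assms(4) by (simp_all add: infinitesimal_deformation_def D_def)

  have "even_linear (heisenberg_h2 \<alpha>) (heisenberg_h2 \<alpha>) \<alpha>"
    using assms(1) by (simp add: hom_lie_superalgebra_def heisenberg_h2_def)
  then obtain p a b c d where
    \<alpha>_eq: "\<And>x. \<alpha> x = vector [p * x $ 1, a * x $ 2 + c * x $ 3, b * x $ 2 + d * x $ 3]"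
    using even_linear_12_eq[of \<alpha>] unfolding even_linear_def heisenberg_h2_def
    by (metis hom_superalgebra.select_convs(1,2))
  \<comment> \<open>\<open>\<phi>\<close> is the difference of the brackets at \<open>t = 1\<close> and \<open>t = 0\<close>, hence skew like both of them.\<close>
  have \<phi>_skew: "\<phi> x y = - (super_sign i j *s \<phi> y x)"
    if "x \<in> part12 i" "y \<in> part12 j" for i j x y
  proof -
    have 0: "brk (D 0) x y = - (super_sign i j *s brk (D 0) y x)"
      and 1: "brk (D 1) x y = - (super_sign i j *s brk (D 1) y x)"
      using skew[of 0] skew[of 1] that unfolding super_skew_def D_sel by blast+
    have "\<phi> x y = brk (D 1) x y - brk (D 0) x y"
      by (simp add: D_brk)
    also have "\<dots> = - (super_sign i j *s (brk (D 1) y x - brk (D 0) y x))"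
      unfolding 0 1 by (simp add: vec_eq_iff right_diff_distrib)
    also have "brk (D 1) y x - brk (D 0) y x = \<phi> y x"
      by (simp add: D_brk)
    finally show ?thesis .
  qed
  have "even_bilinear (heisenberg_h2 \<alpha>) \<phi>"
    using assms(4) by (simp add: infinitesimal_deformation_def)
  then have \<phi>_bilinear: "\<And>x. Vector_Spaces.linear (*s) (*s) (\<phi> x)"
      "\<And>y. Vector_Spaces.linear (*s) (*s) (\<lambda>x. \<phi> x y)"
      "\<And>i j x y. x \<in> part12 i \<Longrightarrow> y \<in> part12 j \<Longrightarrow> \<phi> x y \<in> part12 (i + j)"
    by (simp_all add: even_bilinear_def heisenberg_h2_def)
  obtain r s w q A B C where
    \<phi>_eq: "\<phi> = bracket12 (vector [0, r, s]) (vector [0, w, q])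
              (vector [A, 0, 0]) (vector [B, 0, 0]) (vector [C, 0, 0])"
    by (rule even_bilinear_12_eq[OF \<phi>_bilinear \<phi>_skew])
  have D_brk_eq: "brk (D t) = bracket12 (vector [0, t * r, 1 + t * s]) (vector [0, t * w, t * q])
      (vector [t * A, 0, 0]) (vector [t * B, 0, 0]) (vector [t * C, 0, 0])" for t
    by (simp add: D_brk \<phi>_eq bracket12_def fun_eq_iff vec_eq_iff forall_3 axis_def algebra_simps)

  have not_all_0: "\<not> (A = 0 \<and> B = 0 \<and> C = 0)"
  proof
    assume *: "A = 0 \<and> B = 0 \<and> C = 0"
    have "super_space (D t)"
      using assms(1)
      by (simp add: hom_lie_superalgebra_def super_space_def D_def deform_def heisenberg_h2_def)
    then have "lie_superalgebra (D t)"
      by (rule lie_superalgebra_if_odd_brackets_zero[of _ "vector [0, t * r, 1 + t * s]"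
            "vector [0, t * w, t * q]"]) (use * in \<open>simp_all add: D_brk_eq vector_0_3\<close>)
    then show False
      using assms(6) by (simp add: D_def)
  qed

  have "\<alpha> (bracket12 (axis 3 1) 0 0 0 0 x y) = bracket12 (axis 3 1) 0 0 0 0 (\<alpha> x) (\<alpha> y)" for x y
    using assms(2) by (simp add: multiplicative_def heisenberg_h2_def)
  from this[of "axis 1 1" "axis 2 1"] have c: "c = 0" and d: "d = p * a"
    by (simp_all add: \<alpha>_eq bracket12_def vec_eq_iff forall_3 axis_def)

  \<comment> \<open>The coefficient at \<open>h\<close> of the odd Hom-Jacobi identity for \<open>x v + y h\<close> has the form
    \<open>t (X + t Y)\<close> up to sign; the parameters \<open>1\<close> and \<open>- 1\<close> separate its two orders \<open>X\<close> and \<open>Y\<close>.\<close>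
  have cube: "(x * x * A + 2 * (x * y) * B + y * y * C) * (a * x) = 0 \<and>
      (x * x * A + 2 * (x * y) * B + y * y * C) * (s * (a * x) + q * (b * x + d * y)) = 0" for x y
  proof -
    define X where "X = (x * x * A + 2 * (x * y) * B + y * y * C) * (a * x)"
    define Y where
      "Y = (x * x * A + 2 * (x * y) * B + y * y * C) * (s * (a * x) + q * (b * x + d * y))"
    have "t * (X + t * Y) = 0" for t
    proof -
      have "brk (D t) (\<alpha> (vector [0, x, y])) (brk (D t) (vector [0, x, y]) (vector [0, x, y])) $ 3
          = - (t * (X + t * Y))"
        by (simp add: D_brk_eq \<alpha>_eq c bracket12_def X_def Y_def algebra_simps)
      then show ?thesis
        using hom_jacobi_odd_cube[OF jac[of t], of "vector [0, x, y]"] by (simp add: part12_1)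
    qed
    from this[of 1] this[of "- 1"] have "X + Y = 0" "X - Y = 0"
      by simp_all
    then have "X = 0" "Y = 0"
      by auto
    then show ?thesis
      by (simp only: X_def Y_def)
  qed
  have a: "a = 0"
    using quadratic_form_eq_0[of A B C a] cube not_all_0 by blast

  have comm: "\<alpha> (\<phi> x y) = \<phi> (\<alpha> x) (\<alpha> y)" for x y
    using assms(4) by (simp add: infinitesimal_deformation_def heisenberg_h2_def)
  have "p * A = b * b * C" "p * B = 0" "p * C = 0"
    using comm[of "axis 2 1" "axis 2 1"] comm[of "axis 2 1" "axis 3 1"]
      comm[of "axis 3 1" "axis 3 1"]
    by (simp_all add: \<alpha>_eq \<phi>_eq bracket12_def vec_eq_iff forall_3 axis_def a c d)
  then have p: "p = 0"
    using not_all_0 by auto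
  have b: "b \<noteq> 0"
  proof
    assume "b = 0"
    then have "\<alpha> = (\<lambda>x. 0)"
      by (simp add: fun_eq_iff \<alpha>_eq vec_eq_iff forall_3 a c d p)
    then show False
      using assms(3) by contradiction
  qed
  have C: "C = 0"
    using \<open>p * A = b * b * C\<close> p b by simp
  have r: "r = 0" and w: "w = 0"
    using comm[of "axis 1 1" "axis 2 1"] comm[of "axis 1 1" "axis 3 1"] b
    by (simp_all add: \<alpha>_eq \<phi>_eq bracket12_def vec_eq_iff forall_3 axis_def a c d p)
  have q: "q = 0"
    using quadratic_form_eq_0[of A B C "q * b"] cube not_all_0 b
    by (auto simp: a d mult.assoc)

  have "hom_lie_isomorphic (D t) (L45 1 ((1 + t * s) / b) (b * (t * B)) (t * A))"
    by (rule isomorphic_L45)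
      (simp_all add: D_brk_eq \<alpha>_eq r w q C vector_0_3 a c d p b)
  then show ?thesis
    unfolding D_def by blast
qed

end
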